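(* There exists a fadelian ring which is neither left Noetherian nor right Noetherian.
   Context: All rings are nontrivial ($1\neq 0$), unital, associative, and not assumed commutative. A ring $R$ is fadelian if for every $x\in R$ and every nonzero $a\in R$ there exist $b,c\in R$ such that $x=ab+ca$. *)

theory Defs
  imports "HOL-Algebra.Ideal"
begin

locale fadelian_ring = ring R for R (structure) +
  assumes one_not_zero: "\<one> \<noteq> \<zero>"
    and fadelian: "\<lbrakk>x \<in> carrier R; a \<in> carrier R; a \<noteq> \<zero>\<rbrakk> \<Longrightarrow>
      \<exists>b \<in> carrier R. \<exists>c \<in> carrier R. x = a \<otimes> b \<oplus> c \<otimes> a"

(* The library's ideal and noetherian_ring are two-sided notions, too weak for
   noncommutative rings; the one-sided versions are therefore introduced here. *)

locale left_ideal = additive_subgroup I R + ring R for I and R (structure) +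
  assumes left_closed: "\<lbrakk>a \<in> I; x \<in> carrier R\<rbrakk> \<Longrightarrow> x \<otimes> a \<in> I"

locale right_ideal = additive_subgroup I R + ring R for I and R (structure) +
  assumes right_closed: "\<lbrakk>a \<in> I; x \<in> carrier R\<rbrakk> \<Longrightarrow> a \<otimes> x \<in> I"

locale left_noetherian_ring = ring R for R (structure) +
  assumes left_acc: "\<lbrakk>\<And>n::nat. left_ideal (J n) R; \<And>n. J n \<subseteq> J (Suc n)\<rbrakk> \<Longrightarrow>
      \<exists>N. \<forall>n\<ge>N. J n = J N"

locale right_noetherian_ring = ring R for R (structure) +
  assumes right_acc: "\<lbrakk>\<And>n::nat. right_ideal (J n) R; \<And>n. J n \<subseteq> J (Suc n)\<rbrakk> \<Longrightarrow>
      \<exists>N. \<forall>n\<ge>N. J n = J N"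

end

theory Submission
  imports Defs "HOL-Algebra.Weak_Morphisms" "HOL-Algebra.Algebraic_Closure_Type"
    "HOL-Library.Countable_Set"
begin

text \<open>
  The argument produces a fadelian ring which is not a division ring, and then passes to an
  ultrapower.

  Passing to the ultrapower destroys both chain conditions. A fadelian ring \<open>R\<close> has no zero
  divisors (\<open>fadelian_ring.integral\<close>). Since being fadelian is a first-order property, it is
  inherited by an ultrapower of \<open>R\<close> along a free ultrafilter on the natural numbers
  (\<open>ultrapower_is_fadelian\<close>). If \<open>a\<close> is a nonzero nonunit of \<open>R\<close>, then the element \<open>s\<^sub>k\<close> of
  the ultrapower that is represented by the sequence \<open>n \<mapsto> a\<^bsup>n-k\<^esup>\<close> satisfies
  \<open>s\<^sub>k = a s\<^sub>k\<^sub>+\<^sub>1 = s\<^sub>k\<^sub>+\<^sub>1 a\<close>, because these equations hold at all \<open>n > k\<close>. Cancellation shows that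
  \<open>s\<^sub>k\<^sub>+\<^sub>1\<close> is not a multiple of \<open>s\<^sub>k\<close> on either side. Hence the left ideals generated by the
  \<open>s\<^sub>k\<close> increase strictly, and so do the right ideals (\<open>ultrapower_has_divisor_chain\<close>).

  The base ring is the ring \<open>S = K[\<phi>, \<phi>\<^bsup>-1\<^esup>]\<close> of twisted Laurent polynomials in the Frobenius
  map \<open>\<phi>\<close> of an algebraically closed field \<open>K\<close> of prime characteristic \<open>p\<close>, acting on \<open>K\<close> by
  additive maps. Three facts make it fadelian:
  \<^item> every nonzero element of \<open>S\<close> is a surjective map, since \<open>K\<close> is algebraically closed;
  \<^item> an element of \<open>S\<close> which vanishes at \<open>v \<noteq> 0\<close> is of the form \<open>h \<circ> \<ell>\<close>, where \<open>h\<close> lies in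
    \<open>S\<close> and \<open>\<ell>(x) = x\<^sup>p - v\<^bsup>p-1\<^esup> x\<close>;
  \<^item> a nonzero additive polynomial is \<open>h \<circ> \<phi>\<close> with \<open>h\<close> of lower degree, or a scalar, or it has a
    nonzero root and the previous fact applies.

  One proves more than is asked: \<open>S = aS + Sg\<close> for all nonzero \<open>a\<close> and \<open>g\<close>
  (\<open>laurent_two_sided\<close>). This allows an induction on the degree of \<open>g\<close> alone. If \<open>g = h \<circ> \<ell>\<close>
  and \<open>x \<in> S\<close>, surjectivity of \<open>a\<close> yields a scalar \<open>\<beta>\<close> for which \<open>x - a\<beta>\<close> vanishes at \<open>v\<close>, so
  that \<open>x = a\<beta> + x'\<ell>\<close>; writing \<open>x' = ab + ch\<close> gives \<open>x = a(\<beta> + b\<ell>) + cg\<close>. Finally,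
  \<open>x\<^sup>p - x\<close> is a nonunit because it is not injective.

  For \<open>K\<close> one takes the algebraic closure of the field with two elements. It is countable,
  so the elements of the ultrapower, which are sets of sequences in a countable ring, can be coded
  by sets of sets of natural numbers.
\<close>

section \<open>Fadelian rings have no zero divisors\<close>

context fadelian_ring
begin

text \<open>
  If \<open>e\<^sup>2 = 0\<close> and \<open>e \<noteq> 0\<close>, then \<open>x = eb + ce\<close> gives \<open>exe = e\<^sup>2be + ece\<^sup>2 = 0\<close> for every \<open>x\<close>.
  Multiplying \<open>1 = eb + ce\<close> by \<open>e\<close> from the left then gives \<open>e = e\<^sup>2b + ece = 0\<close>.
\<close>

lemma square_zero_imp_zero:
  assumes e: "e \<in> carrier R" and sq: "e \<otimes> e = \<zero>"
  shows "e = \<zero>"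
proof (rule ccontr)
  assume "e \<noteq> \<zero>"
  have sandwich: "e \<otimes> x \<otimes> e = \<zero>" if x: "x \<in> carrier R" for x
  proof -
    obtain b c where bc: "b \<in> carrier R" "c \<in> carrier R" "x = e \<otimes> b \<oplus> c \<otimes> e"
      using fadelian[OF x e \<open>e \<noteq> \<zero>\<close>] by blast
    have "e \<otimes> x \<otimes> e = (e \<otimes> e) \<otimes> b \<otimes> e \<oplus> e \<otimes> c \<otimes> (e \<otimes> e)"
      using e bc by (simp add: l_distr r_distr m_assoc)
    then show ?thesis
      using e bc by (simp add: sq)
  qed
  obtain b c where bc: "b \<in> carrier R" "c \<in> carrier R" "\<one> = e \<otimes> b \<oplus> c \<otimes> e"
    using fadelian[OF one_closed e \<open>e \<noteq> \<zero>\<close>] by blast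
  have "e = e \<otimes> (e \<otimes> b \<oplus> c \<otimes> e)"
    unfolding bc(3)[symmetric] using e by simp
  also have "\<dots> = (e \<otimes> e) \<otimes> b \<oplus> e \<otimes> c \<otimes> e"
    using e bc by (simp add: r_distr m_assoc)
  also have "\<dots> = \<zero>"
    using e bc by (simp add: sq sandwich)
  finally show False
    using \<open>e \<noteq> \<zero>\<close> by simp
qed

text \<open>
  If \<open>ab = 0\<close>, then \<open>(bxa)\<^sup>2 = bx(ab)xa = 0\<close>, hence \<open>bxa = 0\<close>, for every \<open>x\<close>. If \<open>b \<noteq> 0\<close>,
  multiplying \<open>1 = by + zb\<close> by \<open>a\<close> from the left gives \<open>a = azb\<close>, hence \<open>a\<^sup>2 = az(ba) = 0\<close>.
\<close>

lemma integral:
  assumes a: "a \<in> carrier R" and b: "b \<in> carrier R" and ab: "a \<otimes> b = \<zero>"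
  shows "a = \<zero> \<or> b = \<zero>"
proof (rule disjCI)
  assume "b \<noteq> \<zero>"
  have sandwich: "b \<otimes> x \<otimes> a = \<zero>" if x: "x \<in> carrier R" for x
  proof (rule square_zero_imp_zero)
    have "(b \<otimes> x \<otimes> a) \<otimes> (b \<otimes> x \<otimes> a) = b \<otimes> x \<otimes> (a \<otimes> b) \<otimes> x \<otimes> a"
      using a b x by (simp add: m_assoc)
    then show "(b \<otimes> x \<otimes> a) \<otimes> (b \<otimes> x \<otimes> a) = \<zero>"
      using a b x by (simp add: ab)
  qed (use a b x in simp)
  obtain y z where yz: "y \<in> carrier R" "z \<in> carrier R" "\<one> = b \<otimes> y \<oplus> z \<otimes> b"
    using fadelian[OF one_closed b \<open>b \<noteq> \<zero>\<close>] by blast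
  have "a = a \<otimes> (b \<otimes> y \<oplus> z \<otimes> b)"
    unfolding yz(3)[symmetric] using a by simp
  also have "\<dots> = (a \<otimes> b) \<otimes> y \<oplus> a \<otimes> z \<otimes> b"
    using a b yz by (simp add: r_distr m_assoc)
  finally have "a = a \<otimes> z \<otimes> b"
    using a b yz by (simp add: ab)
  then have "a \<otimes> a = a \<otimes> z \<otimes> (b \<otimes> \<one> \<otimes> a)"
    using a b yz by (metis m_assoc m_closed r_one)
  then have "a \<otimes> a = \<zero>"
    unfolding sandwich[OF one_closed] using a yz by simp
  then show "a = \<zero>"
    by (rule square_zero_imp_zero[OF a])
qed

lemma cancel_left:
  assumes "a \<in> carrier R" "a \<noteq> \<zero>" "x \<in> carrier R" "y \<in> carrier R" "a \<otimes> x = a \<otimes> y"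
  shows "x = y"
proof -
  have "a \<otimes> (x \<ominus> y) = \<zero>"
    using assms by (simp add: a_minus_def r_distr r_minus r_neg)
  then show ?thesis
    using integral[of a "x \<ominus> y"] assms by (simp add: r_right_minus_eq)
qed

lemma cancel_right:
  assumes "a \<in> carrier R" "a \<noteq> \<zero>" "x \<in> carrier R" "y \<in> carrier R" "x \<otimes> a = y \<otimes> a"
  shows "x = y"
proof -
  have "(x \<ominus> y) \<otimes> a = \<zero>"
    using assms by (simp add: a_minus_def l_distr l_minus r_neg)
  then show ?thesis
    using integral[of "x \<ominus> y" a] assms by (simp add: r_right_minus_eq)
qed

text \<open>
  This reduces right invertibility to left invertibility, so that one notion of nonunit serves
  both chain conditions.
\<close>

lemma left_inverse_imp_right_inverse:
  assumes "a \<in> carrier R" "y \<in> carrier R" "a \<otimes> y = \<one>"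
  shows "y \<otimes> a = \<one>"
proof (rule cancel_left)
  show "a \<noteq> \<zero>"
    using assms one_not_zero by auto
  show "a \<otimes> (y \<otimes> a) = a \<otimes> \<one>"
    using assms by (simp flip: m_assoc)
qed (use assms in auto)

lemma pow_nonzero:
  assumes "a \<in> carrier R" "a \<noteq> \<zero>"
  shows "a [^] (n::nat) \<noteq> \<zero>"
proof (induction n)
  case (Suc n)
  then show ?case
    using assms integral[of "a [^] n" a] by auto
qed (use one_not_zero in simp)

end

section \<open>Chains of divisors\<close>

text \<open>
  The principal left ideals generated by the \<open>s k\<close> form a strictly increasing chain. Stating
  the obstruction through elements makes it easy to transport along injections.
\<close>

lemma divisor_chain_imp_not_left_noetherian:
  fixes s :: "nat \<Rightarrow> 'a"
  assumes R: "ring R" and s: "\<And>k. s k \<in> carrier R"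
    and dvd: "\<And>k. \<exists>y\<in>carrier R. s k = y \<otimes>\<^bsub>R\<^esub> s (Suc k)"
    and proper: "\<And>k y. y \<in> carrier R \<Longrightarrow> s (Suc k) \<noteq> y \<otimes>\<^bsub>R\<^esub> s k"
  shows "\<not> left_noetherian_ring R"
proof
  assume "left_noetherian_ring R"
  then interpret left_noetherian_ring R .
  define J where "J k = (\<lambda>y. y \<otimes>\<^bsub>R\<^esub> s k) ` carrier R" for k
  have "\<exists>N. \<forall>n\<ge>N. J n = J N"
  proof (rule left_acc)
    fix n
    show "left_ideal (J n) R"
    proof (intro left_ideal.intro left_ideal_axioms.intro additive_subgroup.intro)
      show "subgroup (J n) (add_monoid R)"
      proof (rule add.subgroupI)
        fix a assume "a \<in> J n"
        then obtain y where y: "y \<in> carrier R" "a = y \<otimes>\<^bsub>R\<^esub> s n"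
          by (auto simp: J_def)
        show "\<ominus>\<^bsub>R\<^esub> a \<in> J n"
          unfolding J_def by (rule image_eqI[of _ _ "\<ominus>\<^bsub>R\<^esub> y"]) (use y s in \<open>auto simp: l_minus\<close>)
        fix b assume "b \<in> J n"
        then obtain z where z: "z \<in> carrier R" "b = z \<otimes>\<^bsub>R\<^esub> s n"
          by (auto simp: J_def)
        show "a \<oplus>\<^bsub>R\<^esub> b \<in> J n"
          unfolding J_def by (rule image_eqI[of _ _ "y \<oplus>\<^bsub>R\<^esub> z"]) (use y z s in \<open>auto simp: l_distr\<close>)
      qed (use s in \<open>auto simp: J_def\<close>)
      show "x \<otimes>\<^bsub>R\<^esub> a \<in> J n" if a: "a \<in> J n" and x: "x \<in> carrier R" for a x
      proof -
        obtain y where y: "y \<in> carrier R" "a = y \<otimes>\<^bsub>R\<^esub> s n"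
          using a by (auto simp: J_def)
        show ?thesis
          unfolding J_def by (rule image_eqI[of _ _ "x \<otimes>\<^bsub>R\<^esub> y"]) (use x y s in \<open>auto simp: m_assoc\<close>)
      qed
    qed (rule R)
    obtain y where y: "y \<in> carrier R" "s n = y \<otimes>\<^bsub>R\<^esub> s (Suc n)"
      using dvd by blast
    have "z \<otimes>\<^bsub>R\<^esub> s n = (z \<otimes>\<^bsub>R\<^esub> y) \<otimes>\<^bsub>R\<^esub> s (Suc n)" if "z \<in> carrier R" for z
      unfolding y(2) using that y(1) s by (simp add: m_assoc)
    then show "J n \<subseteq> J (Suc n)"
      unfolding J_def using y(1) by (blast intro: m_closed)
  qed
  then obtain N where "J (Suc N) = J N"
    by (metis le_SucI order_refl)
  moreover have "s (Suc N) \<in> J (Suc N)"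
    unfolding J_def by (rule image_eqI[of _ _ "\<one>\<^bsub>R\<^esub>"]) (use s in auto)
  ultimately show False
    using proper by (auto simp: J_def)
qed

lemma divisor_chain_imp_not_right_noetherian:
  fixes s :: "nat \<Rightarrow> 'a"
  assumes R: "ring R" and s: "\<And>k. s k \<in> carrier R"
    and dvd: "\<And>k. \<exists>y\<in>carrier R. s k = s (Suc k) \<otimes>\<^bsub>R\<^esub> y"
    and proper: "\<And>k y. y \<in> carrier R \<Longrightarrow> s (Suc k) \<noteq> s k \<otimes>\<^bsub>R\<^esub> y"
  shows "\<not> right_noetherian_ring R"
proof
  assume "right_noetherian_ring R"
  then interpret right_noetherian_ring R .
  define J where "J k = (\<lambda>y. s k \<otimes>\<^bsub>R\<^esub> y) ` carrier R" for k
  have "\<exists>N. \<forall>n\<ge>N. J n = J N"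
  proof (rule right_acc)
    fix n
    show "right_ideal (J n) R"
    proof (intro right_ideal.intro right_ideal_axioms.intro additive_subgroup.intro)
      show "subgroup (J n) (add_monoid R)"
      proof (rule add.subgroupI)
        fix a assume "a \<in> J n"
        then obtain y where y: "y \<in> carrier R" "a = s n \<otimes>\<^bsub>R\<^esub> y"
          by (auto simp: J_def)
        show "\<ominus>\<^bsub>R\<^esub> a \<in> J n"
          unfolding J_def by (rule image_eqI[of _ _ "\<ominus>\<^bsub>R\<^esub> y"]) (use y s in \<open>auto simp: r_minus\<close>)
        fix b assume "b \<in> J n"
        then obtain z where z: "z \<in> carrier R" "b = s n \<otimes>\<^bsub>R\<^esub> z"
          by (auto simp: J_def)
        show "a \<oplus>\<^bsub>R\<^esub> b \<in> J n"
          unfolding J_def by (rule image_eqI[of _ _ "y \<oplus>\<^bsub>R\<^esub> z"]) (use y z s in \<open>auto simp: r_distr\<close>)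
      qed (use s in \<open>auto simp: J_def\<close>)
      show "a \<otimes>\<^bsub>R\<^esub> x \<in> J n" if a: "a \<in> J n" and x: "x \<in> carrier R" for a x
      proof -
        obtain y where y: "y \<in> carrier R" "a = s n \<otimes>\<^bsub>R\<^esub> y"
          using a by (auto simp: J_def)
        show ?thesis
          unfolding J_def by (rule image_eqI[of _ _ "y \<otimes>\<^bsub>R\<^esub> x"]) (use x y s in \<open>auto simp: m_assoc\<close>)
      qed
    qed (rule R)
    obtain y where y: "y \<in> carrier R" "s n = s (Suc n) \<otimes>\<^bsub>R\<^esub> y"
      using dvd by blast
    have "s n \<otimes>\<^bsub>R\<^esub> z = s (Suc n) \<otimes>\<^bsub>R\<^esub> (y \<otimes>\<^bsub>R\<^esub> z)" if "z \<in> carrier R" for z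
      unfolding y(2) using that y(1) s by (simp add: m_assoc)
    then show "J n \<subseteq> J (Suc n)"
      unfolding J_def using y(1) by (blast intro: m_closed)
  qed
  then obtain N where "J (Suc N) = J N"
    by (metis le_SucI order_refl)
  moreover have "s (Suc N) \<in> J (Suc N)"
    unfolding J_def by (rule image_eqI[of _ _ "\<one>\<^bsub>R\<^esub>"]) (use s in auto)
  ultimately show False
    using proper by (auto simp: J_def)
qed

section \<open>Ultrapowers\<close>

definition ultrafilter :: "'i filter \<Rightarrow> bool" where
  "ultrafilter F \<longleftrightarrow> F \<noteq> bot \<and> (\<forall>P. eventually P F \<or> (\<forall>\<^sub>F i in F. \<not> P i))"

text \<open>
  Smaller filters are finer, so an ultrafilter is a minimal element among the proper filters below
  \<open>G\<close>. Zorn's lemma applies because a set is eventual for the infimum of a chain only if it is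
  eventual for some member of the chain.
\<close>

lemma ultrafilter_exists:
  assumes "G \<noteq> (bot :: 'i filter)"
  shows "\<exists>F \<le> G. ultrafilter F"
proof -
  let ?A = "{F. F \<noteq> bot \<and> F \<le> G}"
  have "\<exists>m\<in>?A. \<forall>a\<in>?A. m \<ge> a \<longrightarrow> a = m"
  proof (rule predicate_Zorn)
    show "partial_order_on ?A (relation_of (\<ge>) ?A)"
      by (rule partial_order_on_relation_ofI) auto
    fix C assume C: "C \<in> Chains (relation_of (\<ge>) ?A)"
    show "\<exists>u\<in>?A. \<forall>a\<in>C. a \<ge> u"
    proof (cases "C = {}")
      case True
      then show ?thesis using assms by auto
    next
      case False
      have sub: "C \<subseteq> ?A" and tot: "\<And>x y. x \<in> C \<Longrightarrow> y \<in> C \<Longrightarrow> x \<le> y \<or> y \<le> x"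
        using C by (auto simp: Chains_def relation_of_def)
      have "eventually P (Inf C) \<longleftrightarrow> (\<exists>b\<in>C. eventually P b)" for P
        by (rule eventually_Inf_base[OF False]) (metis tot inf.absorb1 inf.absorb2 order_refl)
      then have "Inf C \<noteq> bot"
        using sub by (auto simp: trivial_limit_def)
      moreover have "Inf C \<le> G"
        using False sub by (auto intro: Inf_lower2)
      ultimately show ?thesis
        by (auto intro: Inf_lower)
    qed
  qed
  then obtain F where F: "F \<noteq> bot" "F \<le> G" and min: "\<And>F'. F' \<noteq> bot \<Longrightarrow> F' \<le> F \<Longrightarrow> F' = F"
    by (auto intro: order_trans)
  \<comment> \<open>If \<open>P\<close> fails to be eventually false, \<open>F\<close> can be refined so that \<open>P\<close> holds; by minimality it already holds.\<close>
  have "eventually P F \<or> (\<forall>\<^sub>F i in F. \<not> P i)" for P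
  proof (rule disjCI)
    assume "\<not> (\<forall>\<^sub>F i in F. \<not> P i)"
    then have "inf F (principal {i. P i}) \<noteq> bot"
      by (simp add: trivial_limit_def eventually_inf_principal)
    then have "F \<le> principal {i. P i}"
      using min[OF _ inf_le1] by (metis inf.cobounded2)
    then show "eventually P F"
      by (simp add: le_principal)
  qed
  with F show ?thesis
    by (auto simp: ultrafilter_def)
qed

definition seq_ring :: "('a, 'm) ring_scheme \<Rightarrow> ('i \<Rightarrow> 'a) ring" where
  "seq_ring R = \<lparr>carrier = {f. \<forall>i. f i \<in> carrier R},
     monoid.mult = (\<lambda>f g i. f i \<otimes>\<^bsub>R\<^esub> g i), one = (\<lambda>_. \<one>\<^bsub>R\<^esub>),
     zero = (\<lambda>_. \<zero>\<^bsub>R\<^esub>), add = (\<lambda>f g i. f i \<oplus>\<^bsub>R\<^esub> g i)\<rparr>"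

definition null_ideal :: "'i filter \<Rightarrow> ('a, 'm) ring_scheme \<Rightarrow> ('i \<Rightarrow> 'a) set" where
  "null_ideal F R = {f \<in> carrier (seq_ring R). \<forall>\<^sub>F i in F. f i = \<zero>\<^bsub>R\<^esub>}"

definition ultrapower :: "'i filter \<Rightarrow> ('a, 'm) ring_scheme \<Rightarrow> ('i \<Rightarrow> 'a) set ring" where
  "ultrapower F R = seq_ring R Quot null_ideal F R"

definition seq_class :: "'i filter \<Rightarrow> ('a, 'm) ring_scheme \<Rightarrow> ('i \<Rightarrow> 'a) \<Rightarrow> ('i \<Rightarrow> 'a) set" where
  "seq_class F R f = null_ideal F R +>\<^bsub>seq_ring R\<^esub> f"

lemma seq_ring_simps [simp]:
  "f \<in> carrier (seq_ring R) \<longleftrightarrow> (\<forall>i. f i \<in> carrier R)"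
  "f \<otimes>\<^bsub>seq_ring R\<^esub> g = (\<lambda>i. f i \<otimes>\<^bsub>R\<^esub> g i)"
  "f \<oplus>\<^bsub>seq_ring R\<^esub> g = (\<lambda>i. f i \<oplus>\<^bsub>R\<^esub> g i)"
  "\<one>\<^bsub>seq_ring R\<^esub> = (\<lambda>_. \<one>\<^bsub>R\<^esub>)" "\<zero>\<^bsub>seq_ring R\<^esub> = (\<lambda>_. \<zero>\<^bsub>R\<^esub>)"
  by (simp_all add: seq_ring_def)

context ring
begin

lemma seq_ring_is_ring: "ring (seq_ring R :: ('i \<Rightarrow> 'a) ring)"
proof (intro ringI abelian_groupI monoidI)
  fix f :: "'i \<Rightarrow> 'a" assume "f \<in> carrier (seq_ring R)"
  then show "\<exists>g\<in>carrier (seq_ring R). g \<oplus>\<^bsub>seq_ring R\<^esub> f = \<zero>\<^bsub>seq_ring R\<^esub>"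
    by (intro bexI[of _ "\<lambda>i. \<ominus> f i"]) (auto simp: l_neg)
qed (auto simp: fun_eq_iff a_assoc m_assoc l_distr r_distr intro: a_comm)

lemma seq_ring_uminus:
  assumes "f \<in> carrier (seq_ring R)"
  shows "\<ominus>\<^bsub>seq_ring R\<^esub> f = (\<lambda>i. \<ominus> f i)"
proof -
  interpret P: ring "seq_ring R :: ('i \<Rightarrow> 'a) ring"
    by (rule seq_ring_is_ring)
  show ?thesis
    by (rule P.minus_equality) (use assms in \<open>auto simp: l_neg\<close>)
qed

lemma null_ideal_is_ideal: "ideal (null_ideal F R) (seq_ring R)"
proof -
  interpret P: ring "seq_ring R :: ('i \<Rightarrow> 'a) ring"
    by (rule seq_ring_is_ring)
  show ?thesis
  proof (rule idealI[OF seq_ring_is_ring])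
    show "subgroup (null_ideal F R) (add_monoid (seq_ring R))"
    proof (rule P.add.subgroupI)
      show "null_ideal F R \<noteq> {}"
        by (auto simp: null_ideal_def intro!: exI[of _ "\<lambda>_. \<zero>"])
      show "\<ominus>\<^bsub>seq_ring R\<^esub> f \<in> null_ideal F R" if "f \<in> null_ideal F R" for f
        using that by (auto simp: null_ideal_def seq_ring_uminus elim: eventually_mono)
      show "f \<oplus>\<^bsub>seq_ring R\<^esub> g \<in> null_ideal F R" if "f \<in> null_ideal F R" "g \<in> null_ideal F R" for f g
        using that by (auto simp: null_ideal_def elim: eventually_elim2)
    qed (auto simp: null_ideal_def)
  qed (auto simp: null_ideal_def elim!: eventually_mono)
qed

lemma ultrapower_is_ring: "ring (ultrapower F R)"
  unfolding ultrapower_def by (rule ideal.quotient_is_ring[OF null_ideal_is_ideal])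

lemma ultrapower_carrier: "carrier (ultrapower F R) = seq_class F R ` {f. \<forall>i. f i \<in> carrier R}"
  by (auto simp: ultrapower_def seq_class_def FactRing_def A_RCOSETS_def')

lemma ultrapower_carrier_subset: "carrier (ultrapower F R) \<subseteq> Pow {f. \<forall>i. f i \<in> carrier R}"
proof -
  have "null_ideal F R \<subseteq> carrier (seq_ring R)"
    by (auto simp: null_ideal_def)
  then have "seq_class F R f \<subseteq> {g. \<forall>i. g i \<in> carrier R}" if "\<And>i. f i \<in> carrier R" for f
    unfolding seq_class_def
    using abelian_monoid.a_r_coset_subset_G[OF abelian_group.axioms(1)[OF ring.is_abelian_group[OF seq_ring_is_ring]], of _ f] that
    by (simp add: seq_ring_def)
  then show ?thesis
    unfolding ultrapower_carrier by (intro image_subsetI PowI) simp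
qed

lemma seq_class_eq_iff:
  assumes "\<And>i. f i \<in> carrier R" "\<And>i. g i \<in> carrier R"
  shows "seq_class F R f = seq_class F R g \<longleftrightarrow> (\<forall>\<^sub>F i in F. f i = g i)"
proof -
  have "f \<ominus>\<^bsub>seq_ring R\<^esub> g = (\<lambda>i. f i \<ominus> g i)"
    using assms by (simp add: a_minus_def seq_ring_uminus[of g])
  then show ?thesis
    unfolding seq_class_def using assms
    by (subst ring.quotient_eq_iff_same_a_r_cos[OF seq_ring_is_ring null_ideal_is_ideal, symmetric])
       (auto simp: null_ideal_def r_right_minus_eq)
qed

lemma seq_class_hom:
  "ring_hom_ring (seq_ring R) (ultrapower F R) (seq_class F R)"
  unfolding ultrapower_def seq_class_def
  by (rule ideal.rcos_ring_hom_ring[OF null_ideal_is_ideal])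

lemma seq_class_simps:
  shows "\<one>\<^bsub>ultrapower F R\<^esub> = seq_class F R (\<lambda>_. \<one>)"
    and "\<zero>\<^bsub>ultrapower F R\<^esub> = seq_class F R (\<lambda>_. \<zero>)"
    and "\<lbrakk>\<And>i. f i \<in> carrier R; \<And>i. g i \<in> carrier R\<rbrakk> \<Longrightarrow>
      seq_class F R f \<otimes>\<^bsub>ultrapower F R\<^esub> seq_class F R g = seq_class F R (\<lambda>i. f i \<otimes> g i)"
    and "\<lbrakk>\<And>i. f i \<in> carrier R; \<And>i. g i \<in> carrier R\<rbrakk> \<Longrightarrow>
      seq_class F R f \<oplus>\<^bsub>ultrapower F R\<^esub> seq_class F R g = seq_class F R (\<lambda>i. f i \<oplus> g i)"
proof -
  interpret h: ring_hom_ring "seq_ring R" "ultrapower F R" "seq_class F R"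
    by (rule seq_class_hom)
  show "\<one>\<^bsub>ultrapower F R\<^esub> = seq_class F R (\<lambda>_. \<one>)" "\<zero>\<^bsub>ultrapower F R\<^esub> = seq_class F R (\<lambda>_. \<zero>)"
    using h.hom_one h.hom_zero by simp_all
  show "seq_class F R f \<otimes>\<^bsub>ultrapower F R\<^esub> seq_class F R g = seq_class F R (\<lambda>i. f i \<otimes> g i)"
    and "seq_class F R f \<oplus>\<^bsub>ultrapower F R\<^esub> seq_class F R g = seq_class F R (\<lambda>i. f i \<oplus> g i)"
    if "\<And>i. f i \<in> carrier R" "\<And>i. g i \<in> carrier R" for f g
    using h.hom_mult[of f g] h.hom_add[of f g] that by simp_all
qed

end

text \<open>
  Here the ultrafilter property enters: a nonzero element of the ultrapower is represented by a
  sequence that is nonzero at almost all indices, not merely at infinitely many of them. At these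
  indices the equation \<open>x = ab + ca\<close> is solved in \<open>R\<close>.
\<close>

lemma ultrapower_is_fadelian:
  assumes F: "ultrafilter F" and "fadelian_ring R"
  shows "fadelian_ring (ultrapower F R)"
proof -
  interpret R: fadelian_ring R by fact
  have nontriv: "\<not> (\<forall>\<^sub>F i in F. False)"
    using F by (simp add: ultrafilter_def trivial_limit_def)
  show ?thesis
  proof (intro fadelian_ring.intro fadelian_ring_axioms.intro R.ultrapower_is_ring)
    show "\<one>\<^bsub>ultrapower F R\<^esub> \<noteq> \<zero>\<^bsub>ultrapower F R\<^esub>"
      using nontriv R.one_not_zero by (simp add: R.seq_class_simps R.seq_class_eq_iff)
    fix x a
    assume "x \<in> carrier (ultrapower F R)" "a \<in> carrier (ultrapower F R)" and nz: "a \<noteq> \<zero>\<^bsub>ultrapower F R\<^esub>"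
    then obtain xs as where xs: "\<And>i. xs i \<in> carrier R" "x = seq_class F R xs"
      and as: "\<And>i. as i \<in> carrier R" "a = seq_class F R as"
      by (auto simp: R.ultrapower_carrier)
    have ev: "\<forall>\<^sub>F i in F. as i \<noteq> \<zero>\<^bsub>R\<^esub>"
      using nz as F by (auto simp: R.seq_class_simps R.seq_class_eq_iff ultrafilter_def)
    have "\<forall>i. \<exists>b c. b \<in> carrier R \<and> c \<in> carrier R \<and>
        (as i \<noteq> \<zero>\<^bsub>R\<^esub> \<longrightarrow> xs i = as i \<otimes>\<^bsub>R\<^esub> b \<oplus>\<^bsub>R\<^esub> c \<otimes>\<^bsub>R\<^esub> as i)"
      using R.fadelian xs as by (metis R.zero_closed)
    then obtain b c where bc: "\<And>i. b i \<in> carrier R" "\<And>i. c i \<in> carrier R"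
      "\<And>i. as i \<noteq> \<zero>\<^bsub>R\<^esub> \<Longrightarrow> xs i = as i \<otimes>\<^bsub>R\<^esub> b i \<oplus>\<^bsub>R\<^esub> c i \<otimes>\<^bsub>R\<^esub> as i"
      by metis
    have "x = a \<otimes>\<^bsub>ultrapower F R\<^esub> seq_class F R b
        \<oplus>\<^bsub>ultrapower F R\<^esub> seq_class F R c \<otimes>\<^bsub>ultrapower F R\<^esub> a"
      using xs as bc ev
      by (auto simp: R.seq_class_simps R.seq_class_eq_iff elim!: eventually_mono)
    then show "\<exists>b\<in>carrier (ultrapower F R). \<exists>c\<in>carrier (ultrapower F R).
        x = a \<otimes>\<^bsub>ultrapower F R\<^esub> b \<oplus>\<^bsub>ultrapower F R\<^esub> c \<otimes>\<^bsub>ultrapower F R\<^esub> a"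
      using bc by (auto simp: R.ultrapower_carrier)
  qed
qed

text \<open>
  The element \<open>s k\<close> is \<open>a\<^bsup>n-k\<^esup>\<close> for an infinitely large exponent \<open>n\<close>, so one can divide by
  \<open>a\<close> forever. The exponents use truncated subtraction, which is harmless because the filter
  ignores the indices \<open>n \<le> k\<close>.
\<close>

lemma ultrapower_has_divisor_chain:
  assumes F: "F \<noteq> bot" "F \<le> sequentially" and "fadelian_ring R"
    and a: "a \<in> carrier R" "a \<noteq> \<zero>\<^bsub>R\<^esub>"
    and nonunit: "\<And>y. y \<in> carrier R \<Longrightarrow> y \<otimes>\<^bsub>R\<^esub> a \<noteq> \<one>\<^bsub>R\<^esub>"
  defines "s \<equiv> \<lambda>k. seq_class F R (\<lambda>n. a [^]\<^bsub>R\<^esub> (n - k))"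
  shows "\<And>k. s k \<in> carrier (ultrapower F R)"
    and "\<And>k. \<exists>y\<in>carrier (ultrapower F R). s k = y \<otimes>\<^bsub>ultrapower F R\<^esub> s (Suc k)"
    and "\<And>k y. y \<in> carrier (ultrapower F R) \<Longrightarrow> s (Suc k) \<noteq> y \<otimes>\<^bsub>ultrapower F R\<^esub> s k"
    and "\<And>k. \<exists>y\<in>carrier (ultrapower F R). s k = s (Suc k) \<otimes>\<^bsub>ultrapower F R\<^esub> y"
    and "\<And>k y. y \<in> carrier (ultrapower F R) \<Longrightarrow> s (Suc k) \<noteq> s k \<otimes>\<^bsub>ultrapower F R\<^esub> y"
proof -
  interpret R: fadelian_ring R by fact
  have large: "\<forall>\<^sub>F n in F. k < n" for k
    using F(2) eventually_gt_at_top[of k] by (rule filter_leD)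
  have ex: "\<exists>n>k. P n" if "\<forall>\<^sub>F n in F. P n" for P k
    using eventually_happens'[OF F(1) eventually_conj[OF large[of k] that]] .
  show "s k \<in> carrier (ultrapower F R)" for k
    using a by (auto simp: s_def R.ultrapower_carrier)
  let ?a = "seq_class F R (\<lambda>_. a)"
  have a_carrier: "?a \<in> carrier (ultrapower F R)"
    using a by (auto simp: R.ultrapower_carrier)
  have split: "a [^]\<^bsub>R\<^esub> (n - k) = a [^]\<^bsub>R\<^esub> (n - Suc k) \<otimes>\<^bsub>R\<^esub> a"
    "a [^]\<^bsub>R\<^esub> (n - k) = a \<otimes>\<^bsub>R\<^esub> a [^]\<^bsub>R\<^esub> (n - Suc k)" if "k < n" for n k
    using that a by (simp_all add: Suc_diff_Suc flip: R.nat_pow_Suc R.nat_pow_Suc2)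
  have "s k = ?a \<otimes>\<^bsub>ultrapower F R\<^esub> s (Suc k)" for k
    unfolding s_def using a large[of k]
    by (auto simp: R.seq_class_simps R.seq_class_eq_iff split(2) elim!: eventually_mono)
  then show "\<exists>y\<in>carrier (ultrapower F R). s k = y \<otimes>\<^bsub>ultrapower F R\<^esub> s (Suc k)" for k
    using a_carrier by blast
  have "s k = s (Suc k) \<otimes>\<^bsub>ultrapower F R\<^esub> ?a" for k
    unfolding s_def using a large[of k]
    by (auto simp: R.seq_class_simps R.seq_class_eq_iff split(1) elim!: eventually_mono)
  then show "\<exists>y\<in>carrier (ultrapower F R). s k = s (Suc k) \<otimes>\<^bsub>ultrapower F R\<^esub> y" for k
    using a_carrier by blast
  show "s (Suc k) \<noteq> y \<otimes>\<^bsub>ultrapower F R\<^esub> s k" if y: "y \<in> carrier (ultrapower F R)" for k y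
  proof
    assume eq: "s (Suc k) = y \<otimes>\<^bsub>ultrapower F R\<^esub> s k"
    obtain ys where ys: "\<And>n. ys n \<in> carrier R" "y = seq_class F R ys"
      using y by (auto simp: R.ultrapower_carrier)
    then have "\<forall>\<^sub>F n in F. a [^]\<^bsub>R\<^esub> (n - Suc k) = ys n \<otimes>\<^bsub>R\<^esub> a [^]\<^bsub>R\<^esub> (n - k)"
      using eq a by (simp add: s_def R.seq_class_simps R.seq_class_eq_iff)
    then obtain n where n: "n > k" "a [^]\<^bsub>R\<^esub> (n - Suc k) = ys n \<otimes>\<^bsub>R\<^esub> a [^]\<^bsub>R\<^esub> (n - k)"
      using ex by blast
    have "(ys n \<otimes>\<^bsub>R\<^esub> a) \<otimes>\<^bsub>R\<^esub> a [^]\<^bsub>R\<^esub> (n - Suc k) = \<one>\<^bsub>R\<^esub> \<otimes>\<^bsub>R\<^esub> a [^]\<^bsub>R\<^esub> (n - Suc k)"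
      using n(2) unfolding split(2)[OF n(1)] using a ys(1) by (simp add: R.m_assoc)
    then have "ys n \<otimes>\<^bsub>R\<^esub> a = \<one>\<^bsub>R\<^esub>"
      by (rule R.cancel_right[rotated 4]) (use a ys R.pow_nonzero in auto)
    then show False
      using nonunit ys by blast
  qed
  show "s (Suc k) \<noteq> s k \<otimes>\<^bsub>ultrapower F R\<^esub> y" if y: "y \<in> carrier (ultrapower F R)" for k y
  proof
    assume eq: "s (Suc k) = s k \<otimes>\<^bsub>ultrapower F R\<^esub> y"
    obtain ys where ys: "\<And>n. ys n \<in> carrier R" "y = seq_class F R ys"
      using y by (auto simp: R.ultrapower_carrier)
    then have "\<forall>\<^sub>F n in F. a [^]\<^bsub>R\<^esub> (n - Suc k) = a [^]\<^bsub>R\<^esub> (n - k) \<otimes>\<^bsub>R\<^esub> ys n"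
      using eq a by (simp add: s_def R.seq_class_simps R.seq_class_eq_iff)
    then obtain n where n: "n > k" "a [^]\<^bsub>R\<^esub> (n - Suc k) = a [^]\<^bsub>R\<^esub> (n - k) \<otimes>\<^bsub>R\<^esub> ys n"
      using ex by blast
    have "a [^]\<^bsub>R\<^esub> (n - Suc k) \<otimes>\<^bsub>R\<^esub> (a \<otimes>\<^bsub>R\<^esub> ys n) = a [^]\<^bsub>R\<^esub> (n - Suc k) \<otimes>\<^bsub>R\<^esub> \<one>\<^bsub>R\<^esub>"
      using n(2) unfolding split(1)[OF n(1)] using a ys(1) by (simp add: R.m_assoc)
    then have "a \<otimes>\<^bsub>R\<^esub> ys n = \<one>\<^bsub>R\<^esub>"
      by (rule R.cancel_left[rotated 4]) (use a ys R.pow_nonzero in auto)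
    then show False
      using nonunit ys R.left_inverse_imp_right_inverse a by blast
  qed
qed

section \<open>Twisted Laurent polynomials over an algebraically closed field\<close>

text \<open>
  Additive polynomials are kept as functions rather than as formal twisted polynomials: composition
  is then the product and associativity is free. The index bounds the degree in the Frobenius map,
  strictly, so that \<open>additive_polys 0\<close> contains only the zero map.
\<close>

definition additive_polys :: "nat \<Rightarrow> ('a::field \<Rightarrow> 'a) set" where
  "additive_polys n = {f. \<exists>c. \<forall>x. f x = (\<Sum>i<n. c i * x ^ (CHAR('a) ^ i))}"

text \<open>
  Over an algebraically closed field, a negative power of the Frobenius map can always be moved to the left end, where it becomes the
  extraction of a \<open>p\<^sup>k\<close>-th root. Hence the twisted Laurent polynomials are exactly the maps some
  \<open>p\<^sup>k\<close>-th power of which is an additive polynomial.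
\<close>

definition laurent_polys :: "('a::field \<Rightarrow> 'a) set" where
  "laurent_polys = {f. \<exists>k n. (\<lambda>x. f x ^ (CHAR('a) ^ k)) \<in> additive_polys n}"

definition laurent_ring :: "('a::field \<Rightarrow> 'a) ring" where
  "laurent_ring = \<lparr>carrier = laurent_polys, monoid.mult = (\<circ>), one = id,
     zero = (\<lambda>_. 0), add = (\<lambda>f g x. f x + g x)\<rparr>"

text \<open>
  The exponents are kept abstract since two families occur: the exponents \<open>p\<^sup>i\<close>, for the
  surjectivity of additive polynomials, and the exponents \<open>p\<^sup>i - 1\<close>, for finding a nonzero root of
  an additive polynomial after division by the variable. Distinctness of the exponents prevents
  cancellation, so the polynomial is not constant.
\<close>

lemma sparse_polynomial_root:
  fixes c :: "nat \<Rightarrow> 'a::alg_closed_field"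
  assumes inj: "inj_on e {..<n}" and j: "j < n" "c j \<noteq> 0" "e j > 0"
  shows "\<exists>z. (\<Sum>i<n. c i * z ^ e i) = y"
proof -
  define P where "P = (\<Sum>i<n. monom (c i) (e i)) - [:y:]"
  have "coeff P (e j) = (\<Sum>i<n. if e i = e j then c i else 0)"
    using j by (simp add: P_def coeff_sum coeff_pCons')
  also have "\<dots> = (\<Sum>i<n. if i = j then c i else 0)"
    using inj j by (intro sum.cong) (auto simp: inj_on_def)
  finally have "coeff P (e j) = c j"
    using j by simp
  then have "coeff P (e j) \<noteq> 0"
    using j by simp
  then have "degree P > 0"
    using le_degree[of P "e j"] j by simp
  then obtain z where "poly P z = 0"
    using alg_closed_imp_poly_has_root by blast
  then show ?thesis
    by (auto simp: P_def poly_sum poly_monom)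
qed

lemma additive_polysI:
  "(\<And>x::'a::field. f x = (\<Sum>i<n. c i * x ^ (CHAR('a) ^ i))) \<Longrightarrow> f \<in> additive_polys n"
  by (auto simp: additive_polys_def)

lemma additive_polysE:
  assumes "(f :: 'a::field \<Rightarrow> 'a) \<in> additive_polys n"
  obtains c where "\<And>x. f x = (\<Sum>i<n. c i * x ^ (CHAR('a) ^ i))"
  using assms by (auto simp: additive_polys_def)

lemma additive_polys_mono:
  fixes f :: "'a::field \<Rightarrow> 'a"
  assumes "f \<in> additive_polys m" "m \<le> n"
  shows "f \<in> additive_polys n"
proof -
  obtain c where c: "\<And>x. f x = (\<Sum>i<m. c i * x ^ (CHAR('a) ^ i))"
    using assms(1) by (rule additive_polysE) blast
  show ?thesis
  proof (rule additive_polysI)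
    fix x
    show "f x = (\<Sum>i<n. (if i < m then c i else 0) * x ^ (CHAR('a) ^ i))"
      unfolding c using assms(2) by (intro sum.mono_neutral_cong_left) auto
  qed
qed

lemma additive_polys_zero: "(\<lambda>_. 0) \<in> additive_polys n"
  by (rule additive_polysI[where c = "\<lambda>_. 0"]) simp

lemma additive_polys_add:
  fixes f g :: "'a::field \<Rightarrow> 'a"
  assumes "f \<in> additive_polys m" "g \<in> additive_polys n"
  shows "(\<lambda>x. f x + g x) \<in> additive_polys (max m n)"
proof -
  have "f \<in> additive_polys (max m n)" "g \<in> additive_polys (max m n)"
    using assms by (auto elim: additive_polys_mono)
  then obtain c d where "\<And>x. f x = (\<Sum>i<max m n. c i * x ^ (CHAR('a) ^ i))"
    "\<And>x. g x = (\<Sum>i<max m n. d i * x ^ (CHAR('a) ^ i))"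
    by (elim additive_polysE) blast
  then show ?thesis
    by (intro additive_polysI[where c = "\<lambda>i. c i + d i"]) (simp add: sum.distrib algebra_simps)
qed

lemma additive_polys_scale:
  fixes f :: "'a::field \<Rightarrow> 'a"
  assumes "f \<in> additive_polys n"
  shows "(\<lambda>x. a * f x) \<in> additive_polys n"
proof -
  obtain c where "\<And>x. f x = (\<Sum>i<n. c i * x ^ (CHAR('a) ^ i))"
    using assms by (rule additive_polysE) blast
  then show ?thesis
    by (intro additive_polysI[where c = "\<lambda>i. a * c i"]) (simp add: sum_distrib_left mult_ac)
qed

lemma additive_polys_sum:
  fixes f :: "nat \<Rightarrow> 'a::field \<Rightarrow> 'a"
  assumes "\<And>i. i < m \<Longrightarrow> f i \<in> additive_polys n"
  shows "(\<lambda>x. \<Sum>i<m. f i x) \<in> additive_polys n"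
  using assms
proof (induction m)
  case (Suc m)
  then show ?case
    using additive_polys_add[of "\<lambda>x. \<Sum>i<m. f i x" n "f m" n] by simp
qed (simp add: additive_polys_zero)

lemma additive_polys_monomial: "(\<lambda>x::'a::field. a * x ^ (CHAR('a) ^ k)) \<in> additive_polys (Suc k)"
  by (rule additive_polysI[where c = "\<lambda>i. if i = k then a else 0"]) simp

context
  assumes prime_char: "prime CHAR('a::alg_closed_field)"
begin

lemma q_pos: "CHAR('a) ^ k > 0"
  using prime_char prime_gt_0_nat by simp

lemma frob_add: "(x + y :: 'a) ^ CHAR('a) ^ k = x ^ CHAR('a) ^ k + y ^ CHAR('a) ^ k"
  by (rule freshmans_dream'[OF prime_char refl])

lemma frob_eq_iff: "(x::'a) ^ CHAR('a) ^ k = y ^ CHAR('a) ^ k \<longleftrightarrow> x = y"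
proof
  assume "x ^ CHAR('a) ^ k = y ^ CHAR('a) ^ k"
  then have "(x - y) ^ CHAR('a) ^ k = 0"
    using frob_add[of "x - y" y k] by simp
  then show "x = y"
    by simp
qed simp

lemma frob_surj: "\<exists>x::'a. x ^ CHAR('a) ^ k = y"
  using sparse_polynomial_root[of "\<lambda>_. CHAR('a) ^ k" 1 0 "\<lambda>_. 1" y] q_pos by (simp add: inj_on_def)

definition frob_root :: "nat \<Rightarrow> 'a \<Rightarrow> 'a" where
  "frob_root k y = (SOME x. x ^ CHAR('a) ^ k = y)"

lemma frob_root [simp]: "frob_root k y ^ CHAR('a) ^ k = y"
  unfolding frob_root_def by (rule someI_ex[OF frob_surj])

lemma frob_root_eqI: "(x::'a) ^ CHAR('a) ^ k = y \<Longrightarrow> x = frob_root k y"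
  using frob_eq_iff[of x k "frob_root k y"] by simp

lemma frob_frob: "((x::'a) ^ CHAR('a) ^ k) ^ CHAR('a) ^ l = x ^ CHAR('a) ^ (k + l)"
  by (simp add: power_add power_mult)

lemma additive_polys_hom:
  assumes "(f :: 'a \<Rightarrow> 'a) \<in> additive_polys n"
  shows "f (x + y) = f x + f y"
proof -
  obtain c where "\<And>x. f x = (\<Sum>i<n. c i * x ^ CHAR('a) ^ i)"
    using assms by (rule additive_polysE) blast
  then show ?thesis
    by (simp add: frob_add ring_distribs sum.distrib)
qed

lemma additive_polys_frob:
  assumes "(f :: 'a \<Rightarrow> 'a) \<in> additive_polys n"
  shows "(\<lambda>x. f x ^ CHAR('a) ^ k) \<in> additive_polys (n + k)"
proof -
  obtain c where c: "\<And>x. f x = (\<Sum>i<n. c i * x ^ CHAR('a) ^ i)"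
    using assms by (rule additive_polysE) blast
  have "(\<lambda>x. \<Sum>i<n. c i ^ CHAR('a) ^ k * x ^ CHAR('a) ^ (i + k)) \<in> additive_polys (n + k)"
    by (intro additive_polys_sum additive_polys_mono[OF additive_polys_monomial]) simp
  then show ?thesis
    by (simp add: c freshmans_dream_sum'[OF prime_char refl] power_mult_distrib frob_frob)
qed

text \<open>
  The commutation rule \<open>\<phi>\<^sup>k f = f' \<phi>\<^sup>k\<close>, where \<open>f'\<close> arises from \<open>f\<close> by raising the coefficients
  to the power \<open>p\<^sup>k\<close>. It is what makes twisted Laurent polynomials closed under composition.
\<close>

lemma additive_polys_frob_commute:
  assumes "(f :: 'a \<Rightarrow> 'a) \<in> additive_polys n"
  shows "\<exists>f'\<in>additive_polys n. \<forall>x. f x ^ CHAR('a) ^ k = f' (x ^ CHAR('a) ^ k)"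
proof -
  obtain c where c: "\<And>x. f x = (\<Sum>i<n. c i * x ^ CHAR('a) ^ i)"
    using assms by (rule additive_polysE) blast
  have "(\<lambda>x. \<Sum>i<n. c i ^ CHAR('a) ^ k * x ^ CHAR('a) ^ i) \<in> additive_polys n"
    by (rule additive_polysI) (rule refl)
  then show ?thesis
    by (rule bexI[rotated])
       (simp add: c freshmans_dream_sum'[OF prime_char refl] power_mult_distrib frob_frob add.commute)
qed

lemma additive_polys_comp:
  assumes "(f :: 'a \<Rightarrow> 'a) \<in> additive_polys m" "g \<in> additive_polys n"
  shows "(\<lambda>x. f (g x)) \<in> additive_polys (n + m)"
proof -
  obtain c where c: "\<And>x. f x = (\<Sum>i<m. c i * x ^ CHAR('a) ^ i)"
    using assms(1) by (rule additive_polysE) blast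
  have "(\<lambda>x. c i * g x ^ CHAR('a) ^ i) \<in> additive_polys (n + m)" if "i < m" for i
    using additive_polys_mono[OF additive_polys_scale[OF additive_polys_frob[OF assms(2)]], of i "n + m"] that
    by simp
  then show ?thesis
    unfolding c by (rule additive_polys_sum)
qed

lemma additive_polys_surj:
  assumes "(f :: 'a \<Rightarrow> 'a) \<in> additive_polys n" "f z \<noteq> 0"
  shows "\<exists>x. f x = y"
proof -
  obtain c where c: "\<And>x. f x = (\<Sum>i<n. c i * x ^ CHAR('a) ^ i)"
    using assms(1) by (rule additive_polysE) blast
  obtain j where "j < n" "c j \<noteq> 0"
    using assms(2) c by (metis (no_types, lifting) lessThan_iff mult_eq_0_iff sum.neutral)
  then show ?thesis
    unfolding c using prime_gt_1_nat[OF prime_char] q_pos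
    by (intro sparse_polynomial_root[where j = j]) (auto simp: inj_on_def)
qed

text \<open>
  The monic additive polynomial of degree one in the Frobenius map which vanishes at \<open>v\<close>.
\<close>

definition linear_factor :: "'a \<Rightarrow> 'a \<Rightarrow> 'a" where
  "linear_factor v x = x ^ CHAR('a) - v ^ (CHAR('a) - 1) * x"

lemma linear_factor_additive: "linear_factor v \<in> additive_polys 2"
  by (rule additive_polysI[where c = "\<lambda>i. if i = 0 then - (v ^ (CHAR('a) - 1)) else 1"])
     (simp add: linear_factor_def numeral_2_eq_2)

lemma linear_factor_root: "linear_factor v v = 0"
  using prime_gt_0_nat[OF prime_char] by (simp add: linear_factor_def flip: power_Suc2)

text \<open>
  Right division by the linear factor: subtracting \<open>c\<^sub>n\<^sub>+\<^sub>1 \<phi>\<^sup>n \<ell>\<close> cancels the leading term and keeps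
  the zero at \<open>v\<close>. At the end a scalar map vanishing at \<open>v \<noteq> 0\<close> remains, and it must be zero.
\<close>

lemma additive_polys_divide:
  assumes "(f :: 'a \<Rightarrow> 'a) \<in> additive_polys (Suc n)" "f v = 0" "v \<noteq> 0"
  shows "\<exists>g\<in>additive_polys n. \<forall>x. f x = g (linear_factor v x)"
  using assms(1,2)
proof (induction n arbitrary: f)
  case 0
  then obtain c where "\<And>x. f x = (\<Sum>i<Suc 0. c i * x ^ CHAR('a) ^ i)"
    by (elim additive_polysE) blast
  then have "f x = 0" for x
    using 0(2) \<open>v \<noteq> 0\<close> by simp
  then show ?case
    by (intro bexI[OF _ additive_polys_zero]) simp
next
  case (Suc n)
  then obtain c where c: "\<And>x. f x = (\<Sum>i<Suc (Suc n). c i * x ^ CHAR('a) ^ i)"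
    by (elim additive_polysE) blast
  define h where "h x = f x - c (Suc n) * linear_factor v x ^ CHAR('a) ^ n" for x
  define r where "r = c (Suc n) * (v ^ (CHAR('a) - 1)) ^ CHAR('a) ^ n"
  have "linear_factor v x ^ CHAR('a) ^ n + (v ^ (CHAR('a) - 1) * x) ^ CHAR('a) ^ n = x ^ CHAR('a) ^ (Suc n)" for x
    unfolding frob_add[symmetric] by (simp add: linear_factor_def power_mult)
  then have l: "linear_factor v x ^ CHAR('a) ^ n = x ^ CHAR('a) ^ (Suc n) - (v ^ (CHAR('a) - 1)) ^ CHAR('a) ^ n * x ^ CHAR('a) ^ n" for x
    by (metis add_diff_cancel_right' power_mult_distrib)
  have "h = (\<lambda>x. (\<Sum>i<Suc n. c i * x ^ CHAR('a) ^ i) + r * x ^ CHAR('a) ^ n)"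
    unfolding h_def c r_def l by (simp add: algebra_simps)
  moreover have "(\<lambda>x. (\<Sum>i<Suc n. c i * x ^ CHAR('a) ^ i) + r * x ^ CHAR('a) ^ n) \<in> additive_polys (max (Suc n) (Suc n))"
    by (intro additive_polys_add additive_polys_monomial additive_polysI) (rule refl)
  ultimately have "h \<in> additive_polys (Suc n)"
    by simp
  moreover have "h v = 0"
    using Suc.prems linear_factor_root q_pos by (simp add: h_def)
  ultimately obtain g where g: "g \<in> additive_polys n" "\<And>x. h x = g (linear_factor v x)"
    using Suc.IH by blast
  show ?case
  proof (rule bexI[of _ "\<lambda>x. g x + c (Suc n) * x ^ CHAR('a) ^ n"])
    show "(\<lambda>x. g x + c (Suc n) * x ^ CHAR('a) ^ n) \<in> additive_polys (Suc n)"
      using additive_polys_add[OF g(1) additive_polys_monomial[of "c (Suc n)" n]] by simp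
    show "\<forall>x. f x = g (linear_factor v x) + c (Suc n) * linear_factor v x ^ CHAR('a) ^ n"
      by (simp add: h_def flip: g(2))
  qed
qed

lemma laurent_polysI:
  "(\<lambda>x. f x ^ CHAR('a) ^ k) \<in> additive_polys n \<Longrightarrow> (f :: 'a \<Rightarrow> 'a) \<in> laurent_polys"
  by (auto simp: laurent_polys_def)

lemma laurent_polysE:
  assumes "(f :: 'a \<Rightarrow> 'a) \<in> laurent_polys"
  obtains k n where "(\<lambda>x. f x ^ CHAR('a) ^ k) \<in> additive_polys n"
  using assms by (auto simp: laurent_polys_def)

lemma additive_imp_laurent: "(f :: 'a \<Rightarrow> 'a) \<in> additive_polys n \<Longrightarrow> f \<in> laurent_polys"
  by (rule laurent_polysI[where k = 0]) simp

lemma laurent_scale: "(\<lambda>x::'a. a * x) \<in> laurent_polys"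
  using additive_imp_laurent[OF additive_polys_monomial[of a 0]] by simp

lemma laurent_frob: "(\<lambda>x::'a. x ^ CHAR('a) ^ k) \<in> laurent_polys"
  using additive_imp_laurent[OF additive_polys_monomial[of 1 k]] by simp

lemma laurent_frob_root: "frob_root k \<in> laurent_polys"
  using laurent_polysI[of "frob_root k" k] additive_polys_monomial[of 1 0] by simp

lemma laurent_hom:
  assumes "(f :: 'a \<Rightarrow> 'a) \<in> laurent_polys"
  shows "f (x + y) = f x + f y"
proof -
  obtain k n where "(\<lambda>x. f x ^ CHAR('a) ^ k) \<in> additive_polys n"
    using assms by (rule laurent_polysE)
  from additive_polys_hom[OF this] show ?thesis
    by (simp add: frob_eq_iff flip: frob_add)
qed

lemma laurent_add:
  assumes "(f :: 'a \<Rightarrow> 'a) \<in> laurent_polys" "g \<in> laurent_polys"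
  shows "(\<lambda>x. f x + g x) \<in> laurent_polys"
proof -
  obtain k m where f: "(\<lambda>x. f x ^ CHAR('a) ^ k) \<in> additive_polys m"
    using assms(1) by (rule laurent_polysE)
  obtain l n where g: "(\<lambda>x. g x ^ CHAR('a) ^ l) \<in> additive_polys n"
    using assms(2) by (rule laurent_polysE)
  have "(\<lambda>x. f x ^ CHAR('a) ^ (k + l) + g x ^ CHAR('a) ^ (l + k)) \<in> additive_polys (max (m + l) (n + k))"
    using additive_polys_add[OF additive_polys_frob[OF f, of l] additive_polys_frob[OF g, of k]]
    by (simp only: frob_frob)
  then show ?thesis
    by (intro laurent_polysI[where k = "k + l"]) (simp add: frob_add add.commute)
qed

lemma laurent_comp:
  assumes "(f :: 'a \<Rightarrow> 'a) \<in> laurent_polys" "g \<in> laurent_polys"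
  shows "(\<lambda>x. f (g x)) \<in> laurent_polys"
proof -
  obtain k m where f: "(\<lambda>x. f x ^ CHAR('a) ^ k) \<in> additive_polys m"
    using assms(1) by (rule laurent_polysE)
  obtain l n where g: "(\<lambda>x. g x ^ CHAR('a) ^ l) \<in> additive_polys n"
    using assms(2) by (rule laurent_polysE)
  obtain f' where f': "f' \<in> additive_polys m" "\<And>x. f x ^ CHAR('a) ^ (k + l) = f' (x ^ CHAR('a) ^ l)"
    using additive_polys_frob_commute[OF f, of l] by (auto simp: frob_frob)
  show ?thesis
    using additive_polys_comp[OF f'(1) g] by (intro laurent_polysI[where k = "k + l"]) (simp add: f'(2))
qed

lemma laurent_surj:
  assumes "(f :: 'a \<Rightarrow> 'a) \<in> laurent_polys" "f z \<noteq> 0"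
  shows "\<exists>x. f x = y"
proof -
  obtain k m where f: "(\<lambda>x. f x ^ CHAR('a) ^ k) \<in> additive_polys m"
    using assms(1) by (rule laurent_polysE)
  show ?thesis
    using additive_polys_surj[OF f, of z "y ^ CHAR('a) ^ k"] assms(2) by (simp add: frob_eq_iff)
qed

lemma laurent_divide:
  assumes "(f :: 'a \<Rightarrow> 'a) \<in> laurent_polys" "f v = 0" "v \<noteq> 0"
  shows "\<exists>g\<in>laurent_polys. \<forall>x. f x = g (linear_factor v x)"
proof -
  obtain k m where f: "(\<lambda>x. f x ^ CHAR('a) ^ k) \<in> additive_polys m"
    using assms(1) by (rule laurent_polysE)
  obtain g where g: "g \<in> additive_polys m" "\<And>x. f x ^ CHAR('a) ^ k = g (linear_factor v x)"
    using additive_polys_divide[OF additive_polys_mono[OF f], of m v] assms(2,3) q_pos by auto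
  have "f x = frob_root k (g (linear_factor v x))" for x
    by (rule frob_root_eqI) (rule g(2))
  moreover have "(\<lambda>x. frob_root k (g x)) \<in> laurent_polys"
    using laurent_frob_root additive_imp_laurent[OF g(1)] by (rule laurent_comp)
  ultimately show ?thesis
    by (intro bexI[of _ "\<lambda>x. frob_root k (g x)"]) auto
qed

text \<open>
  If the linear coefficient vanishes, a Frobenius map splits off. If all other coefficients vanish,
  the map is a scalar. Otherwise \<open>g(x)/x\<close> is a nonconstant polynomial whose constant coefficient is
  not zero, so that it has a root, and this root is not zero.
\<close>

lemma additive_polys_cases:
  assumes "(g :: 'a \<Rightarrow> 'a) \<in> additive_polys (Suc n)"
  obtains (frob) h where "h \<in> additive_polys n" "\<And>x. g x = h (x ^ CHAR('a) ^ 1)"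
  | (scalar) c where "c \<noteq> 0" "\<And>x. g x = c * x"
  | (factor) h v where "h \<in> additive_polys n" "v \<noteq> 0" "\<And>x. g x = h (linear_factor v x)"
proof -
  obtain c where c: "\<And>x. g x = (\<Sum>i<Suc n. c i * x ^ CHAR('a) ^ i)"
    using assms by (rule additive_polysE) blast
  show thesis
  proof (cases "c 0 = 0")
    case True
    have "g x = (\<Sum>i<n. c (Suc i) * (x ^ CHAR('a) ^ 1) ^ CHAR('a) ^ i)" for x
      unfolding c by (simp add: True frob_frob sum.lessThan_Suc_shift power_mult del: sum.lessThan_Suc)
    then show thesis
      by (intro frob[of "\<lambda>x. \<Sum>i<n. c (Suc i) * x ^ CHAR('a) ^ i"] additive_polysI) auto
  next
    case c0: False
    show thesis
    proof (cases "\<forall>i<n. c (Suc i) = 0")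
      case True
      then show thesis
        using c0 by (intro scalar[of "c 0"])
          (auto simp: c sum.lessThan_Suc_shift simp del: sum.lessThan_Suc)
    next
      case False
      then obtain j where j: "0 < j" "j < Suc n" "c j \<noteq> 0"
        by auto
      have q_inj: "i = j" if "CHAR('a) ^ i - 1 = CHAR('a) ^ j - 1" for i j
        using that q_pos[of i] q_pos[of j] prime_gt_1_nat[OF prime_char]
        by (metis Suc_diff_1 power_inject_exp)
      have "CHAR('a) ^ j > CHAR('a) ^ 0"
        using j prime_gt_1_nat[OF prime_char] by (intro power_strict_increasing) auto
      have "inj_on (\<lambda>i. CHAR('a) ^ i - 1) {..<Suc n}"
        by (rule inj_onI) (rule q_inj)
      then obtain v where v: "(\<Sum>i<Suc n. c i * v ^ (CHAR('a) ^ i - 1)) = 0"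
        using sparse_polynomial_root[of "\<lambda>i. CHAR('a) ^ i - 1" "Suc n" j c 0] j(2,3)
          \<open>CHAR('a) ^ j > CHAR('a) ^ 0\<close>
        by (metis power_0 zero_less_diff)
      have "v \<noteq> 0"
      proof
        assume "v = 0"
        have "CHAR('a) ^ (Suc i) - 1 \<noteq> 0" for i
          using q_inj[of "Suc i" 0] by auto
        then have "(\<Sum>i<Suc n. c i * v ^ (CHAR('a) ^ i - 1)) = c 0"
          unfolding sum.lessThan_Suc_shift using \<open>v = 0\<close> by (simp add: power_0_left)
        then show False
          using v c0 by simp
      qed
      have "g v = (\<Sum>i<Suc n. c i * v ^ (CHAR('a) ^ i - 1)) * v"
        unfolding c sum_distrib_right
        by (intro sum.cong refl) (metis Suc_diff_1 mult.assoc power_Suc2 q_pos)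
      then have "g v = 0"
        using v by simp
      then show thesis
        using additive_polys_divide[OF assms _ \<open>v \<noteq> 0\<close>] factor \<open>v \<noteq> 0\<close> by blast
    qed
  qed
qed

text \<open>
  The fadelian property is the case \<open>g = a\<close>. Keeping \<open>a\<close> and \<open>g\<close> independent is essential, since
  the induction replaces \<open>g = h \<circ> \<ell>\<close> by \<open>h\<close> while \<open>a\<close> must stay the same. The
  points \<open>z\<close> and \<open>w\<close> witness that \<open>g\<close> and \<open>a\<close> are not zero.
\<close>

lemma laurent_two_sided:
  assumes "(g :: 'a \<Rightarrow> 'a) \<in> additive_polys n" "g z \<noteq> 0"
    and a: "a \<in> laurent_polys" "a w \<noteq> 0" and "x \<in> laurent_polys"
  shows "\<exists>b\<in>laurent_polys. \<exists>c\<in>laurent_polys. \<forall>t. x t = a (b t) + c (g t)"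
  using assms(1,2,5)
proof (induction n arbitrary: g z x)
  case 0
  then show ?case
    by (auto simp: additive_polys_def)
next
  case (Suc n)
  from Suc.prems(1) show ?case
  proof (cases rule: additive_polys_cases)
    case (frob h)
    have "(\<lambda>t. x (frob_root 1 t)) \<in> laurent_polys"
      by (rule laurent_comp[OF Suc.prems(3) laurent_frob_root])
    then obtain b c where bc: "b \<in> laurent_polys" "c \<in> laurent_polys"
      "\<And>t. x (frob_root 1 t) = a (b t) + c (h t)"
      using Suc.IH[OF frob(1), of "z ^ CHAR('a) ^ 1"] Suc.prems(2) frob(2) by metis
    have "frob_root 1 (t ^ CHAR('a) ^ 1) = t" for t
      by (rule frob_root_eqI[OF refl, symmetric])
    then have "x t = a (b (t ^ CHAR('a) ^ 1)) + c (g t)" for t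
      using bc(3)[of "t ^ CHAR('a) ^ 1"] frob(2) by simp
    then show ?thesis
      by (intro bexI[OF _ laurent_comp[OF bc(1) laurent_frob[of 1]]] bexI[OF _ bc(2)]) simp
  next
    case (scalar s)
    have "a 0 = 0"
      using laurent_hom[OF a(1), of 0 0] by (metis add.right_neutral add_left_cancel)
    then have "x t = a 0 + x (inverse s * g t)" for t
      using scalar by (simp add: mult.assoc[symmetric])
    then show ?thesis
      using laurent_scale[of 0] laurent_comp[OF Suc.prems(3) laurent_scale[of "inverse s"]]
      by (metis mult_zero_left)
  next
    case (factor h v)
    obtain u where u: "a u = x v"
      using laurent_surj[OF a] by blast
    \<comment> \<open>The scalar is chosen such that \<open>x\<close> and \<open>a \<circ> \<beta>\<close> agree at \<open>v\<close>, so the linear factor divides their difference.\<close>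
    define \<beta> where "\<beta> = u / v"
    define y where "y t = x t + (- 1) * a (\<beta> * t)" for t
    have "y \<in> laurent_polys"
      unfolding y_def
      by (intro laurent_add Suc.prems(3) laurent_comp[OF laurent_scale] laurent_comp[OF a(1)] laurent_scale)
    moreover have "y v = 0"
      using u factor(2) by (simp add: y_def \<beta>_def)
    ultimately obtain x' where x': "x' \<in> laurent_polys" "\<And>t. y t = x' (linear_factor v t)"
      using laurent_divide factor(2) by blast
    obtain b c where bc: "b \<in> laurent_polys" "c \<in> laurent_polys" "\<And>t. x' t = a (b t) + c (h t)"
      using Suc.IH[OF factor(1) _ x'(1), of "linear_factor v z"] Suc.prems(2) factor(3) by metis
    have "x t = a (\<beta> * t + b (linear_factor v t)) + c (g t)" for t
      using x'(2)[of t] by (simp add: y_def bc(3) factor(3) laurent_hom[OF a(1)] algebra_simps)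
    moreover have "(\<lambda>t. \<beta> * t + b (linear_factor v t)) \<in> laurent_polys"
      by (intro laurent_add laurent_scale laurent_comp[OF bc(1)] additive_imp_laurent[OF linear_factor_additive])
    ultimately show ?thesis
      by (intro bexI[of _ "\<lambda>t. \<beta> * t + b (linear_factor v t)"] bexI[OF _ bc(2)]) auto
  qed
qed

lemma laurent_ring_is_ring: "ring (laurent_ring :: ('a \<Rightarrow> 'a) ring)"
proof (intro ringI abelian_groupI monoidI)
  fix f :: "'a \<Rightarrow> 'a" assume "f \<in> carrier laurent_ring"
  then show "\<exists>g\<in>carrier laurent_ring. g \<oplus>\<^bsub>laurent_ring\<^esub> f = \<zero>\<^bsub>laurent_ring\<^esub>"
    using laurent_comp[OF laurent_scale[of "-1"], of f]
    by (intro bexI[of _ "\<lambda>x. - 1 * f x"]) (auto simp: laurent_ring_def)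
qed (use laurent_add laurent_comp laurent_scale[of 1] laurent_scale[of 0] laurent_hom in
     \<open>auto simp: laurent_ring_def comp_def id_def fun_eq_iff algebra_simps\<close>)

theorem laurent_ring_is_fadelian: "fadelian_ring (laurent_ring :: ('a \<Rightarrow> 'a) ring)"
proof (intro fadelian_ring.intro fadelian_ring_axioms.intro laurent_ring_is_ring)
  show "\<one>\<^bsub>laurent_ring\<^esub> \<noteq> (\<zero>\<^bsub>laurent_ring\<^esub> :: 'a \<Rightarrow> 'a)"
    by (auto simp: laurent_ring_def fun_eq_iff intro: exI[of _ 1])
  fix x a :: "'a \<Rightarrow> 'a"
  assume "x \<in> carrier laurent_ring" "a \<in> carrier laurent_ring" "a \<noteq> \<zero>\<^bsub>laurent_ring\<^esub>"
  then obtain w where x: "x \<in> laurent_polys" and a: "a \<in> laurent_polys" "a w \<noteq> 0"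
    by (auto simp: laurent_ring_def)
  \<comment> \<open>Powers of the Frobenius map are units, so \<open>a\<close> and \<open>\<phi>\<^sup>k a\<close> generate the same left ideal.\<close>
  obtain k n where g: "(\<lambda>t. a t ^ CHAR('a) ^ k) \<in> additive_polys n"
    using a(1) by (rule laurent_polysE)
  obtain b c where bc: "b \<in> laurent_polys" "c \<in> laurent_polys" "\<And>t. x t = a (b t) + c (a t ^ CHAR('a) ^ k)"
    using laurent_two_sided[OF g, of w a w x] a x by auto
  show "\<exists>b\<in>carrier laurent_ring. \<exists>c\<in>carrier laurent_ring.
      x = a \<otimes>\<^bsub>laurent_ring\<^esub> b \<oplus>\<^bsub>laurent_ring\<^esub> c \<otimes>\<^bsub>laurent_ring\<^esub> a"
  proof (intro bexI)
    show "x = a \<otimes>\<^bsub>laurent_ring\<^esub> b \<oplus>\<^bsub>laurent_ring\<^esub> (\<lambda>t. c (t ^ CHAR('a) ^ k)) \<otimes>\<^bsub>laurent_ring\<^esub> a"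
      using bc(3) by (simp add: laurent_ring_def fun_eq_iff)
  qed (use bc laurent_comp[OF bc(2) laurent_frob[of k]] in \<open>auto simp: laurent_ring_def\<close>)
qed

text \<open>
  The map \<open>x\<^sup>p - x\<close> is not injective, as it vanishes at \<open>0\<close> and at \<open>1\<close>, so it has no left inverse.
\<close>

lemma laurent_ring_has_nonunit:
  "\<exists>a \<in> carrier (laurent_ring :: ('a \<Rightarrow> 'a) ring). a \<noteq> \<zero>\<^bsub>laurent_ring\<^esub> \<and>
     (\<forall>y. y \<otimes>\<^bsub>laurent_ring\<^esub> a \<noteq> \<one>\<^bsub>laurent_ring\<^esub>)"
proof -
  let ?a = "linear_factor 1"
  have "\<exists>z. (\<Sum>i<2. (if i = 0 then - 1 else 1) * z ^ CHAR('a) ^ i) = (1::'a)"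
    using prime_gt_1_nat[OF prime_char] by (intro sparse_polynomial_root[where j = 1]) (auto simp: inj_on_def)
  then have "\<exists>z. ?a z = 1"
    by (simp add: linear_factor_def numeral_2_eq_2)
  moreover have "?a 0 = ?a 1"
    using linear_factor_root[of 1] q_pos[of 1] by (simp add: linear_factor_def)
  then have "y \<circ> ?a \<noteq> id" for y
    by (metis comp_apply id_apply zero_neq_one)
  ultimately show ?thesis
    using additive_imp_laurent[OF linear_factor_additive[of 1]]
    by (intro bexI[of _ ?a]) (auto simp: laurent_ring_def)
qed

lemma laurent_polys_countable:
  assumes "countable (UNIV :: 'a set)"
  shows "countable (laurent_polys :: ('a \<Rightarrow> 'a) set)"
proof (rule countable_subset)
  let ?eval = "\<lambda>(k, cs) x. frob_root k (\<Sum>i<length cs. cs ! i * x ^ CHAR('a) ^ i)"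
  show "countable (?eval ` (UNIV \<times> lists UNIV))"
    using assms by (intro countable_image countable_SIGMA countable_lists) auto
  show "laurent_polys \<subseteq> ?eval ` (UNIV \<times> lists UNIV)"
  proof
    fix f :: "'a \<Rightarrow> 'a" assume "f \<in> laurent_polys"
    then obtain k n where "(\<lambda>x. f x ^ CHAR('a) ^ k) \<in> additive_polys n"
      by (rule laurent_polysE)
    then obtain c where c: "\<And>x. f x ^ CHAR('a) ^ k = (\<Sum>i<n. c i * x ^ CHAR('a) ^ i)"
      by (elim additive_polysE) blast
    have "f x = frob_root k (\<Sum>i<n. c i * x ^ CHAR('a) ^ i)" for x
      by (rule frob_root_eqI) (rule c)
    then show "f \<in> ?eval ` (UNIV \<times> lists UNIV)"
      by (intro image_eqI[of _ _ "(k, map c [0..<n])"]) (auto intro!: ext arg_cong[of _ _ "frob_root k"])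
  qed
qed

end

section \<open>Countability and transport along injections\<close>

text \<open>
  Every element is a root of one of countably many nonzero polynomials, each with finitely many roots.
\<close>

lemma countable_alg_closure:
  assumes "countable (UNIV :: 'a::field set)"
  shows "countable (UNIV :: 'a alg_closure set)"
proof (rule countable_subset)
  have "(UNIV :: 'a poly set) \<subseteq> Poly ` lists UNIV"
    by (metis Poly_coeffs UNIV_I image_eqI lists_UNIV subsetI)
  then have polys: "countable (UNIV :: 'a poly set)"
    using assms by (meson countable_image countable_lists countable_subset)
  show "countable (\<Union>p\<in>{p :: 'a poly. p \<noteq> 0}. {x. poly (map_poly to_ac p) x = 0})"
  proof (rule countable_UN)
    show "countable {p :: 'a poly. p \<noteq> 0}"
      using polys by (rule countable_subset[OF subset_UNIV])
    fix p :: "'a poly" assume "p \<in> {p. p \<noteq> 0}"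
    then have "map_poly to_ac p \<noteq> (0 :: 'a alg_closure poly)"
      by (simp add: map_poly_eq_0_iff)
    then show "countable {x :: 'a alg_closure. poly (map_poly to_ac p) x = 0}"
      by (intro countable_finite poly_roots_finite)
  qed
  show "UNIV \<subseteq> (\<Union>p\<in>{p :: 'a poly. p \<noteq> 0}. {x. poly (map_poly to_ac p) x = 0})"
  proof
    fix x :: "'a alg_closure"
    obtain p :: "'a poly" where "p \<noteq> 0" "poly (map_poly to_ac p) x = 0"
      by (rule alg_closure_algebraic)
    then show "x \<in> (\<Union>p\<in>{p :: 'a poly. p \<noteq> 0}. {x. poly (map_poly to_ac p) x = 0})"
      by blast
  qed
qed

text \<open>
  A sequence in a countable set is coded by its graph, a set of natural numbers.
\<close>

lemma seq_set_embedding: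
  assumes "countable C"
  shows "\<exists>h :: (nat \<Rightarrow> 'a) set \<Rightarrow> nat set set. inj_on h (Pow {f. \<forall>n. f n \<in> C})"
proof -
  define code where "code f = range (\<lambda>n. prod_encode (n, to_nat_on C (f n)))" for f :: "nat \<Rightarrow> 'a"
  have "inj_on code {f. \<forall>n. f n \<in> C}"
  proof (rule inj_onI, rule ext)
    fix f g n
    assume f: "f \<in> {f. \<forall>n. f n \<in> C}" and g: "g \<in> {f. \<forall>n. f n \<in> C}" and eq: "code f = code g"
    have "prod_encode (n, to_nat_on C (f n)) \<in> code g"
      unfolding eq[symmetric] by (auto simp: code_def)
    then have "to_nat_on C (f n) = to_nat_on C (g n)"
      by (auto simp: code_def)
    then show "f n = g n"
      using f g assms by simp
  qed
  then show ?thesis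
    by (intro exI[of _ "image code"] inj_on_image_Pow)
qed

lemma image_ring_simps:
  assumes "inj_on h (carrier R)" "x \<in> carrier R" "y \<in> carrier R"
  shows "h x \<otimes>\<^bsub>image_ring h R\<^esub> h y = h (x \<otimes>\<^bsub>R\<^esub> y)"
    and "h x \<oplus>\<^bsub>image_ring h R\<^esub> h y = h (x \<oplus>\<^bsub>R\<^esub> y)"
  using assms by (simp_all add: image_ring_def image_group_def monoid.defs)

lemma image_ring_fadelian:
  assumes "fadelian_ring R" and h: "inj_on h (carrier R)"
  shows "fadelian_ring (image_ring h R)"
proof -
  interpret fadelian_ring R by fact
  show ?thesis
  proof (intro fadelian_ring.intro fadelian_ring_axioms.intro inj_imp_image_ring_is_ring h)
    show "\<one>\<^bsub>image_ring h R\<^esub> \<noteq> \<zero>\<^bsub>image_ring h R\<^esub>"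
      using one_not_zero h by (simp add: image_ring_one image_ring_zero inj_on_eq_iff)
    fix x a assume "x \<in> carrier (image_ring h R)" "a \<in> carrier (image_ring h R)" "a \<noteq> \<zero>\<^bsub>image_ring h R\<^esub>"
    then obtain x' a' where x': "x' \<in> carrier R" "x = h x'" and a': "a' \<in> carrier R" "a = h a'" "a' \<noteq> \<zero>\<^bsub>R\<^esub>"
      by (auto simp: image_ring_carrier image_ring_zero)
    obtain b c where "b \<in> carrier R" "c \<in> carrier R" "x' = a' \<otimes>\<^bsub>R\<^esub> b \<oplus>\<^bsub>R\<^esub> c \<otimes>\<^bsub>R\<^esub> a'"
      using fadelian[OF x'(1) a'(1,3)] by blast
    then show "\<exists>b\<in>carrier (image_ring h R). \<exists>c\<in>carrier (image_ring h R).
       x = a \<otimes>\<^bsub>image_ring h R\<^esub> b \<oplus>\<^bsub>image_ring h R\<^esub> c \<otimes>\<^bsub>image_ring h R\<^esub> a"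
      using x' a' by (auto simp: image_ring_carrier image_ring_simps[OF h] intro!: bexI)
  qed
qed

theorem theorem13:
  shows "\<exists>R :: nat set set ring.
    fadelian_ring R \<and> \<not> left_noetherian_ring R \<and> \<not> right_noetherian_ring R"
proof -
  let ?S = "laurent_ring :: (gf2 alg_closure \<Rightarrow> gf2 alg_closure) ring"
  have char: "prime CHAR(gf2 alg_closure)"
    by (simp add: prime_CHAR_semidom finite_imp_CHAR_pos)
  interpret S: fadelian_ring ?S
    by (rule laurent_ring_is_fadelian[OF char])
  obtain F where F: "F \<le> sequentially" "ultrafilter F"
    using ultrafilter_exists[OF sequentially_bot] by blast
  let ?U = "ultrapower F ?S"
  have U: "fadelian_ring ?U"
    by (rule ultrapower_is_fadelian[OF F(2) S.fadelian_ring_axioms])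
  then interpret U: fadelian_ring ?U .
  have "countable (laurent_polys :: (gf2 alg_closure \<Rightarrow> gf2 alg_closure) set)"
    by (intro laurent_polys_countable char countable_alg_closure countable_finite finite)
  then obtain h :: "(nat \<Rightarrow> gf2 alg_closure \<Rightarrow> gf2 alg_closure) set \<Rightarrow> nat set set"
    where "inj_on h (Pow {f. \<forall>n. f n \<in> carrier ?S})"
    using seq_set_embedding[of "laurent_polys"] by (auto simp: laurent_ring_def)
  moreover have "carrier ?U \<subseteq> Pow {f. \<forall>n. f n \<in> carrier ?S}"
    by (rule S.ultrapower_carrier_subset)
  ultimately have h: "inj_on h (carrier ?U)"
    by (rule inj_on_subset)
  let ?R = "image_ring h ?U"
  have R: "fadelian_ring ?R"
    by (rule image_ring_fadelian[OF U h])
  then interpret R: fadelian_ring ?R .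
  obtain a where a: "a \<in> carrier ?S" "a \<noteq> \<zero>\<^bsub>?S\<^esub>" "\<And>y. y \<otimes>\<^bsub>?S\<^esub> a \<noteq> \<one>\<^bsub>?S\<^esub>"
    using laurent_ring_has_nonunit[OF char] by blast
  have F': "F \<noteq> bot"
    using F(2) by (simp add: ultrafilter_def)
  define s where "s k = seq_class F ?S (\<lambda>n. a [^]\<^bsub>?S\<^esub> (n - k))" for k
  note s = ultrapower_has_divisor_chain[OF F' F(1) S.fadelian_ring_axioms a, folded s_def]
  have mult: "h x \<otimes>\<^bsub>?R\<^esub> h y = h (x \<otimes>\<^bsub>?U\<^esub> y)" if "x \<in> carrier ?U" "y \<in> carrier ?U" for x y
    by (rule image_ring_simps[OF h that])
  have h_eq: "h x = h y \<longleftrightarrow> x = y" if "x \<in> carrier ?U" "y \<in> carrier ?U" for x y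
    using h that by (rule inj_on_eq_iff)
  have "\<not> left_noetherian_ring ?R"
  proof (rule divisor_chain_imp_not_left_noetherian[where s = "\<lambda>k. h (s k)"])
    show "\<exists>y\<in>carrier ?R. h (s k) = y \<otimes>\<^bsub>?R\<^esub> h (s (Suc k))" for k
      using s(2)[of k] s(1) by (auto simp: image_ring_carrier mult)
    show "h (s (Suc k)) \<noteq> y \<otimes>\<^bsub>?R\<^esub> h (s k)" if "y \<in> carrier ?R" for k y
      using s(3)[of _ k] s(1) that by (auto simp: image_ring_carrier mult h_eq)
  qed (use s(1) R.ring_axioms in \<open>auto simp: image_ring_carrier\<close>)
  moreover have "\<not> right_noetherian_ring ?R"
  proof (rule divisor_chain_imp_not_right_noetherian[where s = "\<lambda>k. h (s k)"])
    show "\<exists>y\<in>carrier ?R. h (s k) = h (s (Suc k)) \<otimes>\<^bsub>?R\<^esub> y" for k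
      using s(4)[of k] s(1) by (auto simp: image_ring_carrier mult)
    show "h (s (Suc k)) \<noteq> h (s k) \<otimes>\<^bsub>?R\<^esub> y" if "y \<in> carrier ?R" for k y
      using s(5)[of _ k] s(1) that by (auto simp: image_ring_carrier mult h_eq)
  qed (use s(1) R.ring_axioms in \<open>auto simp: image_ring_carrier\<close>)
  ultimately show ?thesis
    using R by blast
qed

end
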